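(* Let $p\ge1$, $r\ge1$, $n\ge1$ be integers, let $a\in\mathbb{R}^n$ with $y=\sum_{i=1}^n a_i\ne0$, and let $\widehat{y}$ be the result of computing $y$ by recursive summation with limited-precision stochastic rounding $\mathrm{SR}_{p,r}$, that is, $\widehat{s}_1=a_1$, $\widehat{s}_k=\mathrm{SR}_{p,r}(\widehat{s}_{k-1}+a_k)$ for $k=2,\ldots,n$, and $\widehat{y}=\widehat{s}_n$. Then, for any $0<\lambda<1$, $$\frac{|\widehat{y}-y|}{|y|}\le \kappa(a)\left(\sqrt{\gamma_{n-1}(u_p^2)/\lambda}+\gamma_{n-1}(u_p+u_{p+r})-\gamma_{n-1}(u_p)\right)$$ with probability at least $1-\lambda$.
   Context: Notation: $u_q=2^{1-q}$ for an integer $q\ge1$; $\gamma_m(u)=(1+u)^m-1$; $\kappa(a)=\dfrac{\sum_{i=1}^n|a_i|}{\left|\sum_{i=1}^n a_i\right|}$ is the condition number of the sum. Floating-point numbers: $\mathcal{F}$ is the precision-$p$ binary floating-point system, i.e. the set of $0$ and all real numbers $(-1)^s 2^e m$ with $s\in\{0,1\}$, $e$ an integer exponent, and $m\in[1,2)$ having at most $p$ significant bits. Standard model: no underflow or overflow occurs (the exponent range may be regarded as unlimited). For $x\in\mathbb{R}$, $\lceil x\rceil_p=\min\{y\in\mathcal{F}:y\ge x\}$ and $\lfloor x\rfloor_p=\max\{y\in\mathcal{F}:y\le x\}$. For $x\neq0$ written uniquely as $x=(-1)^s2^em$ with $m\in[1,2)$ real, $\mathrm{ulp}_p(x)=2^{e-p+1}$,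 and $\mathrm{fl}_{p+r}(x)$ is $x$ with the binary expansion of its significand $m$ truncated to the first $p+r$ significant bits; $\mathrm{fl}_{p+r}(0)=0$. Limited-precision stochastic rounding with $r$ random bits: $\mathrm{SR}_{p,r}(0)=0$, and for $x\ne0$, $\mathrm{SR}_{p,r}(x)$ is the random variable equal to $\lceil x\rceil_p$ with probability $q_r(x)$ and to $\lfloor x\rfloor_p$ with probability $1-q_r(x)$, where $q_r(x)=(\mathrm{fl}_{p+r}(x)-\lfloor x\rfloor_p)/\mathrm{ulp}_p(x)$. In an algorithm, the inputs are deterministic and each rounding, conditionally on all previous roundings, has this two-point distribution with $x$ the exact result of the current operation. *)

theory Defs
  imports "HOL-Probability.Probability"
begin

definition unit_roundoff :: "nat \<Rightarrow> real" where
  "unit_roundoff q = 2 powi (1 - int q)"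

definition gamma_err :: "nat \<Rightarrow> real \<Rightarrow> real" where
  "gamma_err m u = (1 + u) ^ m - 1"

text \<open>Vectors in $R^n$ are functions on the naturals of which only the entries
  with index in $1, \ldots, n$ are used.\<close>

definition sum_cond :: "nat \<Rightarrow> (nat \<Rightarrow> real) \<Rightarrow> real" where
  "sum_cond n a = (\<Sum>i = 1..n. \<bar>a i\<bar>) / \<bar>\<Sum>i = 1..n. a i\<bar>"


text \<open>For a significand $m$ in $[1,2)$, having at most $p$ significant bits means one integer
  bit and at most $p - 1$ fractional bits, i.e. $m \cdot 2^{p-1}$ is an integer. The exponent
  ranges over all integers, so that there is neither underflow nor overflow.\<close>

definition floats :: "nat \<Rightarrow> real set" where
  "floats p = {0} \<union> {(-1) ^ s * 2 powi e * m | (s :: nat) (e :: int) (m :: real).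
      s \<in> {0, 1} \<and> 1 \<le> m \<and> m < 2 \<and> m * 2 ^ (p - 1) \<in> \<int>}"

definition fp_ceil :: "nat \<Rightarrow> real \<Rightarrow> real" where
  "fp_ceil p x = (LEAST y. y \<in> floats p \<and> y \<ge> x)"

definition fp_floor :: "nat \<Rightarrow> real \<Rightarrow> real" where
  "fp_floor p x = (GREATEST y. y \<in> floats p \<and> y \<le> x)"

text \<open>Exponent and significand of a nonzero real; see lemma \<open>expo_signif\<close> below.\<close>

definition expo :: "real \<Rightarrow> int" where
  "expo x = \<lfloor>log 2 \<bar>x\<bar>\<rfloor>"

definition signif :: "real \<Rightarrow> real" where
  "signif x = \<bar>x\<bar> / 2 powi expo x"

definition ulp :: "nat \<Rightarrow> real \<Rightarrow> real" where
  "ulp p x = 2 powi (expo x - int p + 1)"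

text \<open>The factor \<open>sgn x\<close> makes the truncation go towards zero for both signs and
  yields the value 0 at 0.\<close>

definition fl_trunc :: "nat \<Rightarrow> real \<Rightarrow> real" where
  "fl_trunc q x = sgn x * 2 powi expo x * (\<lfloor>signif x * 2 ^ (q - 1)\<rfloor> / 2 ^ (q - 1))"

definition sr_prob :: "nat \<Rightarrow> nat \<Rightarrow> real \<Rightarrow> real" where
  "sr_prob p r x = (fl_trunc (p + r) x - fp_floor p x) / ulp p x"

text \<open>The constant \<open>bernoulli_pmf\<close> clips its argument to the unit interval; lemma
  \<open>sr_prob_bounds\<close> below shows that no clipping takes place.\<close>

definition SR :: "nat \<Rightarrow> nat \<Rightarrow> real \<Rightarrow> real pmf" where
  "SR p r x = (if x = 0 then return_pmf 0
     else map_pmf (\<lambda>b. if b then fp_ceil p x else fp_floor p x)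
            (bernoulli_pmf (sr_prob p r x)))"

text \<open>Law of the computed partial sum after \<open>k\<close> terms. Each rounding is a fresh draw from
  \<open>SR\<close> at the exact result of the current addition, whatever the earlier roundings were.
  The equation for index 0 is a dummy.\<close>

fun rec_sum :: "nat \<Rightarrow> nat \<Rightarrow> (nat \<Rightarrow> real) \<Rightarrow> nat \<Rightarrow> real pmf" where
  "rec_sum p r a 0 = return_pmf 0"
| "rec_sum p r a (Suc 0) = return_pmf (a 1)"
| "rec_sum p r a (Suc (Suc k)) =
     bind_pmf (rec_sum p r a (Suc k)) (\<lambda>s. SR p r (s + a (Suc (Suc k))))"


text \<open>The remaining lemmas show that these notions are well defined: the extrema in
  \<open>fp_ceil\<close> and \<open>fp_floor\<close> are attained and \<open>sr_prob\<close> is a probability.\<close>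

lemma powi_shift: "j = i + int d \<Longrightarrow> (2::real) powi j = 2 powi i * 2 ^ d"
  by (simp add: power_int_add)

lemma powi_less_cancel:
  assumes "(2::real) powi i < 2 powi j"
  shows "i < j"
proof (rule ccontr)
  assume "\<not> i < j"
  hence "(2::real) powi j \<le> 2 powi i" by (intro power_int_increasing) auto
  thus False using assms by simp
qed

lemma expo_bounds:
  assumes "x \<noteq> 0"
  shows "2 powi expo x \<le> \<bar>x\<bar>" "\<bar>x\<bar> < 2 powi (expo x + 1)"
proof -
  have *: "\<bar>x\<bar> = 2 powr log 2 \<bar>x\<bar>" using assms by simp
  have "2 powr real_of_int (expo x) \<le> \<bar>x\<bar>"
    by (subst *) (unfold expo_def, rule powr_mono; linarith)
  thus "2 powi expo x \<le> \<bar>x\<bar>" by (simp add: powr_real_of_int')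
  have "\<bar>x\<bar> < 2 powr real_of_int (expo x + 1)"
    by (subst *) (unfold expo_def, rule powr_less_mono; linarith)
  thus "\<bar>x\<bar> < 2 powi (expo x + 1)" using powr_real_of_int'[of 2 "expo x + 1"] by simp
qed

lemma expo_signif:
  assumes "x \<noteq> 0"
  shows "x = sgn x * 2 powi expo x * signif x" "1 \<le> signif x" "signif x < 2"
  using expo_bounds[OF assms]
  by (auto simp: signif_def field_simps power_int_add sgn_mult_abs[symmetric] abs_mult_sgn)

lemma expo_unique:
  assumes "2 powi e \<le> \<bar>x\<bar>" "\<bar>x\<bar> < 2 powi (e + 1)"
  shows "expo x = e"
proof -
  have "\<bar>x\<bar> > 0" using assms(1) by (smt (verit) zero_less_power_int)
  hence x: "x \<noteq> 0" by simp
  have "(2::real) powi e < 2 powi (expo x + 1)" "(2::real) powi expo x < 2 powi (e + 1)"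
    using expo_bounds[OF x] assms by linarith+
  hence "e < expo x + 1" "expo x < e + 1" by (auto dest: powi_less_cancel)
  thus ?thesis by simp
qed

lemma floats_uminus: "- y \<in> floats p \<longleftrightarrow> y \<in> floats p"
proof -
  have "- y \<in> floats p" if y: "y \<in> floats p" for y
  proof (cases "y = 0")
    case False
    then obtain s :: nat and e m where
      *: "y = (-1) ^ s * 2 powi e * m" "s \<in> {0, 1}" "1 \<le> m" "m < 2" "m * 2 ^ (p - 1) \<in> \<int>"
      using y unfolding floats_def by blast
    have "- y = (-1) ^ (1 - s) * 2 powi e * m" "1 - s \<in> {0, 1}" using * by auto
    thus ?thesis using *(3-5) unfolding floats_def by blast
  qed (auto simp: floats_def)
  from this[of y] this[of "- y"] show ?thesis by auto
qed

lemma floats_intI: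
  assumes "p \<ge> 1" "\<bar>k :: int\<bar> \<le> 2 ^ p" "2 ^ (p - 1) \<le> \<bar>k\<bar>"
  shows "real_of_int k * 2 powi (e - int p + 1) \<in> floats p"
proof -
  have pos: "real_of_int k * 2 powi (e - int p + 1) \<in> floats p"
    if "k \<le> 2 ^ p" "2 ^ (p - 1) \<le> k" for k :: int
  proof -
    have pw: "(2::real) powi (e - int p + 1) = 2 powi e / 2 ^ (p - 1)"
    proof -
      have "e = (e - int p + 1) + int (p - 1)" using assms(1) by simp
      from powi_shift[OF this] show ?thesis by (simp add: field_simps)
    qed
    have k1: "(2::real) ^ (p - 1) \<le> real_of_int k" 
      using that(2) by (metis of_int_le_iff of_int_numeral of_int_power)
    show ?thesis
    proof (cases "k = 2 ^ p")
      case True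
      have "real_of_int k = 2 * 2 ^ (p - 1)" using True assms(1) by (cases p) auto
      hence "real_of_int k * 2 powi (e - int p + 1) = (-1) ^ 0 * 2 powi (e + 1) * 1"
        by (simp add: pw power_int_add)
      thus ?thesis unfolding floats_def by (intro UnI2 CollectI exI conjI) (auto simp: Ints_power)
    next
      case False
      hence "k < 2 ^ p" using that by simp
      hence "real_of_int k < 2 ^ p" by (metis of_int_less_iff of_int_numeral of_int_power)
      hence k2: "real_of_int k < 2 * 2 ^ (p - 1)" using assms(1) by (cases p) auto
      have "real_of_int k * 2 powi (e - int p + 1) =
              (-1) ^ 0 * 2 powi e * (real_of_int k / 2 ^ (p - 1))"
        by (simp add: pw)
      thus ?thesis unfolding floats_def using k1 k2
        by (intro UnI2 CollectI exI conjI) (assumption, auto simp: field_simps)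
    qed
  qed
  show ?thesis
  proof (cases "k \<ge> 0")
    case True
    thus ?thesis using pos[of k] assms by simp
  next
    case False
    hence "real_of_int (- k) * 2 powi (e - int p + 1) \<in> floats p"
      using assms by (intro pos) auto
    thus ?thesis using floats_uminus[of "real_of_int k * 2 powi (e - int p + 1)" p] by simp
  qed
qed

lemma floats_grid:
  assumes "p \<ge> 1" "y \<in> floats p" "2 powi e \<le> \<bar>y\<bar>"
  shows "\<exists>k::int. y = real_of_int k * 2 powi (e - int p + 1)"
proof -
  have "\<bar>y\<bar> > 0" using assms(3) by (smt (verit) zero_less_power_int)
  then obtain s :: nat and e' m where
    *: "y = (-1) ^ s * 2 powi e' * m" "s \<in> {0, 1}" "1 \<le> m" "m < 2" "m * 2 ^ (p - 1) \<in> \<int>"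
    using assms(2) by (auto simp: floats_def)
  obtain j :: int where j: "m * 2 ^ (p - 1) = real_of_int j" using *(5) by (auto elim: Ints_cases)
  have "\<bar>y\<bar> = 2 powi e' * m" using * by (auto simp: abs_mult)
  also have "\<dots> < 2 powi (e' + 1)" using *(4) by (simp add: power_int_add)
  finally have "(2::real) powi e < 2 powi (e' + 1)" using assms(3) by linarith
  hence "e \<le> e'" by (auto dest: powi_less_cancel)
  then obtain d :: nat where d: "e' = e + int d" by (metis zle_iff_zadd)
  have "e = (e - int p + 1) + int (p - 1)" using assms(1) by simp
  from powi_shift[OF this] have pw: "(2::real) powi (e - int p + 1) = 2 powi e / 2 ^ (p - 1)"
    by (simp add: field_simps)
  have "y = real_of_int ((-1) ^ s * 2 ^ d * j) * 2 powi (e - int p + 1)"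
    unfolding *(1) pw d by (simp add: power_int_add j[symmetric])
  thus ?thesis by blast
qed

lemma abs_div_ulp_bounds:
  assumes "p \<ge> 1" "x \<noteq> 0"
  shows "2 ^ (p - 1) \<le> \<bar>x\<bar> / ulp p x" "\<bar>x\<bar> / ulp p x < 2 ^ p"
proof -
  have "expo x = (expo x - int p + 1) + int (p - 1)" using assms(1) by simp
  hence 1: "(2::real) powi expo x = ulp p x * 2 ^ (p - 1)"
    unfolding ulp_def by (rule powi_shift)
  have "expo x + 1 = (expo x - int p + 1) + int p" by simp
  hence 2: "(2::real) powi (expo x + 1) = ulp p x * 2 ^ p"
    unfolding ulp_def by (rule powi_shift)
  have "ulp p x > 0" by (simp add: ulp_def)
  thus "2 ^ (p - 1) \<le> \<bar>x\<bar> / ulp p x" "\<bar>x\<bar> / ulp p x < 2 ^ p"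
    using expo_bounds[OF assms(2)] 1 2 by (simp_all add: field_simps)
qed

lemma fp_floor_greatest:
  assumes "p \<ge> 1" "x \<noteq> 0"
  defines "z \<equiv> ulp p x * \<lfloor>x / ulp p x\<rfloor>"
  shows "z \<in> floats p" "z \<le> x" "\<And>y. y \<in> floats p \<Longrightarrow> y \<le> x \<Longrightarrow> y \<le> z"
proof -
  let ?h = "ulp p x" and ?k = "\<lfloor>x / ulp p x\<rfloor>"
  have h: "?h > 0" by (simp add: ulp_def)
  note b = abs_div_ulp_bounds[OF assms(1,2)]
  have K: "\<bar>?k\<bar> \<le> 2 ^ p \<and> 2 ^ (p - 1) \<le> \<bar>?k\<bar> \<and> (x > 0 \<longrightarrow> 2 ^ (p - 1) \<le> ?k)"
  proof (cases "x > 0")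
    case True
    hence "2 ^ (p - 1) \<le> x / ?h" "x / ?h < 2 ^ p" using b by auto
    hence "2 ^ (p - 1) \<le> ?k" "?k < 2 ^ p" by (simp_all add: le_floor_iff floor_less_iff)
    moreover from this have "?k \<ge> 0" by (smt (verit) zero_le_power)
    ultimately show ?thesis by auto
  next
    case False
    have "- (2 ^ p) \<le> x / ?h" "x / ?h \<le> - (2 ^ (p - 1))" using False b assms(2) by auto
    have "real_of_int ?k \<le> x / ?h" by (rule of_int_floor_le)
    also have "\<dots> \<le> - (2 ^ (p - 1))" by fact
    finally have 2: "real_of_int ?k \<le> - (2 ^ (p - 1))" .
    have "- (2 ^ p) \<le> ?k" using \<open>- (2 ^ p) \<le> x / ?h\<close> by (simp add: le_floor_iff)
    moreover have "real_of_int ?k \<le> real_of_int (- (2 ^ (p - 1)))" using 2 by simp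
    hence "?k \<le> - (2 ^ (p - 1))" by (simp only: of_int_le_iff)
    moreover from this have "?k \<le> 0" by (smt (verit) zero_le_power)
    ultimately show ?thesis using False by auto
  qed
  thus "z \<in> floats p"
    using floats_intI[OF assms(1), of ?k "expo x"] by (simp add: z_def ulp_def mult.commute)
  show "z \<le> x" using h unfolding z_def by (metis divide_le_eq floor_divide_lower mult.commute)
  fix y assume y: "y \<in> floats p" "y \<le> x"
  show "y \<le> z"
  proof (cases "2 powi expo x \<le> \<bar>y\<bar>")
    case True
    then obtain k :: int where k: "y = real_of_int k * ?h"
      using floats_grid[OF assms(1) y(1)] unfolding ulp_def by blast
    hence "k \<le> ?k" using y(2) h by (simp add: le_floor_iff field_simps)
    thus ?thesis using h k by (simp add: z_def mult.commute)
  next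
    case False
    have "x > 0"
    proof (rule ccontr)
      assume "\<not> x > 0"
      thus False using False y(2) expo_bounds(1)[OF assms(2)] by linarith
    qed
    hence "(2::int) ^ (p - 1) \<le> ?k" using K by simp
    hence "(2::real) ^ (p - 1) \<le> real_of_int ?k"
      by (metis of_int_le_iff of_int_numeral of_int_power)
    hence "?h * 2 ^ (p - 1) \<le> z" using h by (simp add: z_def)
    moreover have "?h * 2 ^ (p - 1) = 2 powi expo x"
    proof -
      have "expo x = (expo x - int p + 1) + int (p - 1)" using assms(1) by simp
      from powi_shift[OF this] show ?thesis by (simp add: ulp_def)
    qed
    ultimately show ?thesis using False by linarith
  qed
qed

lemma ulp_uminus [simp]: "ulp p (- x) = ulp p x"
  by (simp add: ulp_def expo_def)

lemma fp_floor_eq: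
  assumes "p \<ge> 1" "x \<noteq> 0"
  shows "fp_floor p x = ulp p x * \<lfloor>x / ulp p x\<rfloor>"
  unfolding fp_floor_def using fp_floor_greatest[OF assms] by (intro Greatest_equality) auto

lemma fp_ceil_eq:
  assumes "p \<ge> 1" "x \<noteq> 0"
  shows "fp_ceil p x = ulp p x * \<lceil>x / ulp p x\<rceil>"
proof -
  have x: "- x \<noteq> 0" using assms by simp
  note * = fp_floor_greatest[OF assms(1) x]
  have e: "ulp p x * \<lceil>x / ulp p x\<rceil> = - (ulp p (- x) * \<lfloor>- x / ulp p (- x)\<rfloor>)"
    by (simp add: ceiling_def)
  show ?thesis unfolding fp_ceil_def e
  proof (rule Least_equality)
    fix y assume "y \<in> floats p \<and> x \<le> y"
    thus "- (ulp p (- x) * \<lfloor>- x / ulp p (- x)\<rfloor>) \<le> y"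
      using *(3)[of "- y"] floats_uminus[of y p] by linarith
  next
    show "- (ulp p (- x) * \<lfloor>- x / ulp p (- x)\<rfloor>) \<in> floats p \<and>
          x \<le> - (ulp p (- x) * \<lfloor>- x / ulp p (- x)\<rfloor>)"
      unfolding floats_uminus using *(1,2) by linarith
  qed
qed

lemma fl_trunc_eq:
  assumes "q \<ge> 1" "x \<noteq> 0"
  shows "fl_trunc q x = sgn x * (ulp q x * \<lfloor>\<bar>x\<bar> / ulp q x\<rfloor>)"
proof -
  have "expo x = (expo x - int q + 1) + int (q - 1)" using assms(1) by simp
  from powi_shift[OF this] have "ulp q x = 2 powi expo x / 2 ^ (q - 1)"
    by (simp add: ulp_def field_simps)
  thus ?thesis by (simp add: fl_trunc_def signif_def)
qed

lemma sr_prob_bounds: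
  assumes "p \<ge> 1" "x \<noteq> 0"
  shows "0 \<le> sr_prob p r x" "sr_prob p r x \<le> 1"
proof -
  let ?h = "ulp p x" and ?g = "ulp (p + r) x"
  have h: "?h > 0" "?g > 0" by (simp_all add: ulp_def)
  have "expo x - int p + 1 = (expo x - int (p + r) + 1) + int r" by simp
  hence hg: "?h = ?g * 2 ^ r"
    unfolding ulp_def by (rule powi_shift)
  let ?t = "?g * \<lfloor>\<bar>x\<bar> / ?g\<rfloor>"
  have t1: "?t \<le> \<bar>x\<bar>" using h by (metis divide_le_eq floor_divide_lower mult.commute)
  have "real_of_int \<lfloor>\<bar>x\<bar> / ?h\<rfloor> * 2 ^ r \<le> \<bar>x\<bar> / ?h * 2 ^ r"
    by (intro mult_right_mono of_int_floor_le) simp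
  hence "of_int (\<lfloor>\<bar>x\<bar> / ?h\<rfloor> * 2 ^ r) \<le> \<bar>x\<bar> / ?g" using h hg by (simp add: field_simps)
  hence "\<lfloor>\<bar>x\<bar> / ?h\<rfloor> * 2 ^ r \<le> \<lfloor>\<bar>x\<bar> / ?g\<rfloor>" by (simp add: le_floor_iff)
  hence "real_of_int (\<lfloor>\<bar>x\<bar> / ?h\<rfloor> * 2 ^ r) \<le> real_of_int \<lfloor>\<bar>x\<bar> / ?g\<rfloor>" by (simp only: of_int_le_iff)
  hence t2: "?h * \<lfloor>\<bar>x\<bar> / ?h\<rfloor> \<le> ?t" using h by (simp add: hg mult_ac)
  have fl: "fl_trunc (p + r) x = sgn x * ?t" using assms by (intro fl_trunc_eq) auto
  have f: "fp_floor p x = ?h * \<lfloor>x / ?h\<rfloor>" by (rule fp_floor_eq[OF assms])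
  have "x / ?h < \<lfloor>x / ?h\<rfloor> + 1" by linarith
  hence f2: "x \<le> fp_floor p x + ?h" using h(1) by (simp add: f field_simps)
  have f1: "fp_floor p x \<le> x"
    using fp_floor_greatest(2)[OF assms] by (simp add: f)
  have "fp_floor p x \<le> fl_trunc (p + r) x \<and> fl_trunc (p + r) x \<le> fp_floor p x + ?h"
  proof (cases "x > 0")
    case True
    thus ?thesis using t1 t2 f2 by (auto simp: fl f)
  next
    case False
    hence s: "sgn x = -1" "\<bar>x\<bar> = - x" using assms(2) by auto
    have "\<lceil>x / ?h\<rceil> \<le> \<lfloor>x / ?h\<rfloor> + 1" by (rule ceiling_le) linarith
    hence "?h * \<lceil>x / ?h\<rceil> \<le> ?h * (\<lfloor>x / ?h\<rfloor> + 1)" using h by simp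
    hence "?h * \<lceil>x / ?h\<rceil> \<le> fp_floor p x + ?h" by (simp add: f algebra_simps)
    moreover have "?h * \<lceil>x / ?h\<rceil> = - (?h * \<lfloor>\<bar>x\<bar> / ?h\<rfloor>)" by (simp add: s ceiling_def)
    ultimately show ?thesis using t1 t2 f1 s by (simp add: fl)
  qed
  thus "0 \<le> sr_prob p r x" "sr_prob p r x \<le> 1" using h by (simp_all add: sr_prob_def)
qed

end

theory Submission
  imports Defs
begin

text \<open>
  Write each rounding as \<open>w = x (1 + \<alpha> + \<beta>)\<close>, where \<open>x\<close> is the exact result of the current
  addition, \<open>x (1 + \<beta>)\<close> is the mean of \<open>w\<close> and \<open>x \<alpha>\<close> is the centred fluctuation. Given the past,
  \<open>\<beta>\<close> is deterministic. With \<open>u = u\<^sub>p\<close> and \<open>v = u\<^sub>p\<^sub>+\<^sub>r\<close> one has \<open>\<bar>\<alpha>\<bar> \<le> u\<close>, since \<open>w\<close> and its mean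
  both lie between two floating-point numbers that are at most one ulp apart, and \<open>\<bar>\<beta>\<bar> \<le> v\<close>,
  since the mean of \<open>w\<close> is the truncation of \<open>x\<close> to \<open>p + r\<close> bits (lemmas \<open>SR_dev\<close> and \<open>SR_bias\<close>).

  The computed sums \<open>s\<^sub>k\<close> are compared with an unbiased shadow process in which the factors
  \<open>1 + \<alpha> + \<beta>\<close> are replaced by \<open>1 + \<alpha>\<close>: \<open>z\<^sub>1 = a\<^sub>1\<close> and \<open>z\<^sub>k = (z\<^sub>k\<^sub>-\<^sub>1 + a\<^sub>k) (1 + \<alpha>\<^sub>k)\<close>. Let
  \<open>A\<^sub>k = \<bar>a\<^sub>1\<bar> + \<dots> + \<bar>a\<^sub>k\<bar>\<close> and \<open>y\<^sub>k = a\<^sub>1 + \<dots> + a\<^sub>k\<close>.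

  The bias is controlled surely: induction gives \<open>\<bar>z\<^sub>k\<bar> \<le> A\<^sub>k (1 + u)^(k-1)\<close>, and then
  \<open>\<bar>s\<^sub>k - z\<^sub>k\<bar> \<le> A\<^sub>k ((1 + u + v)^(k-1) - (1 + u)^(k-1))\<close> (lemma \<open>shadow_sure_bounds\<close>).

  The fluctuation is controlled in mean square: \<open>z\<^sub>k\<close> has mean \<open>y\<^sub>k\<close>, and since the \<open>\<alpha>\<^sub>k\<close> are
  conditionally centred, the second moment \<open>V\<^sub>k\<close> of \<open>z\<^sub>k - y\<^sub>k\<close> satisfies
  \<open>V\<^sub>k \<le> (1 + u\<^sup>2) V\<^sub>k\<^sub>-\<^sub>1 + u\<^sup>2 y\<^sub>k\<^sup>2\<close>, whence \<open>V\<^sub>k \<le> A\<^sub>k\<^sup>2 ((1 + u\<^sup>2)^(k-1) - 1)\<close> (lemma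
  \<open>shadow_moments\<close>). Chebyshev's inequality for \<open>z\<^sub>n - y\<^sub>n\<close> and the triangle inequality conclude.
\<close>

section \<open>Mean and deviation of a single stochastic rounding\<close>

lemma unit_roundoff_nonneg: "0 \<le> unit_roundoff q"
  by (simp add: unit_roundoff_def)

lemma ulp_le_unit_roundoff:
  assumes "x \<noteq> 0"
  shows "ulp q x \<le> unit_roundoff q * \<bar>x\<bar>"
proof -
  have "ulp q x = 2 powi (1 - int q) * 2 powi expo x"
    unfolding ulp_def by (subst power_int_add[symmetric]) (auto simp: algebra_simps)
  also have "\<dots> \<le> 2 powi (1 - int q) * \<bar>x\<bar>"
    using expo_bounds(1)[OF assms] by (intro mult_left_mono) auto
  finally show ?thesis by (simp add: unit_roundoff_def)
qed

lemma fl_trunc_error: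
  assumes "q \<ge> 1" "x \<noteq> 0"
  shows "\<bar>fl_trunc q x - x\<bar> \<le> unit_roundoff q * \<bar>x\<bar>"
proof -
  let ?g = "ulp q x"
  have g: "?g > 0" by (simp add: ulp_def)
  have "?g * real_of_int \<lfloor>\<bar>x\<bar> / ?g\<rfloor> \<le> \<bar>x\<bar>" "\<bar>x\<bar> \<le> ?g * real_of_int \<lfloor>\<bar>x\<bar> / ?g\<rfloor> + ?g"
    using floor_divide_lower[OF g, of "\<bar>x\<bar>"] floor_divide_upper[OF g, of "\<bar>x\<bar>"]
    by (simp_all add: algebra_simps)
  hence "\<bar>fl_trunc q x - x\<bar> \<le> ?g"
    unfolding fl_trunc_eq[OF assms] by (cases "x > 0") (use assms(2) in \<open>auto simp: abs_if\<close>)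
  also have "\<dots> \<le> unit_roundoff q * \<bar>x\<bar>" by (rule ulp_le_unit_roundoff[OF assms(2)])
  finally show ?thesis .
qed

text \<open>The first alternative occurs exactly when \<open>x\<close> is a floating-point number.\<close>

lemma fp_floor_ceil_cases:
  assumes "p \<ge> 1" "x \<noteq> 0"
  shows "fp_floor p x = x \<and> fp_ceil p x = x \<or> fp_ceil p x = fp_floor p x + ulp p x"
proof -
  have h: "ulp p x > 0" by (simp add: ulp_def)
  show ?thesis
  proof (cases "x / ulp p x \<in> \<int>")
    case True
    then obtain k :: int where k: "x / ulp p x = of_int k" by (auto elim: Ints_cases)
    hence "x = ulp p x * of_int k" using h by (simp add: field_simps)
    thus ?thesis using k by (simp add: fp_floor_eq[OF assms] fp_ceil_eq[OF assms])
  next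
    case False
    hence "\<lceil>x / ulp p x\<rceil> = \<lfloor>x / ulp p x\<rfloor> + 1" by (simp add: ceiling_altdef) (metis Ints_of_int)
    thus ?thesis by (simp add: fp_floor_eq[OF assms] fp_ceil_eq[OF assms] algebra_simps)
  qed
qed

definition SR_mean :: "nat \<Rightarrow> nat \<Rightarrow> real \<Rightarrow> real" where
  "SR_mean p r x = measure_pmf.expectation (SR p r x) (\<lambda>w. w)"

lemma finite_set_pmf_SR: "finite (set_pmf (SR p r x))"
  by (auto simp: SR_def)

lemma set_pmf_SR:
  assumes "w \<in> set_pmf (SR p r x)" "x \<noteq> 0"
  shows "w = fp_ceil p x \<or> w = fp_floor p x"
  using assms by (auto simp: SR_def split: if_splits)

lemma SR_mean_0: "SR_mean p r 0 = 0"
  by (simp add: SR_mean_def SR_def)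

lemma SR_mean_eq:
  assumes "p \<ge> 1" "x \<noteq> 0"
  shows "SR_mean p r x = fp_floor p x + sr_prob p r x * (fp_ceil p x - fp_floor p x)"
  using assms(2) sr_prob_bounds[OF assms]
  by (simp add: SR_mean_def SR_def algebra_simps)

lemma SR_bias:
  assumes "p \<ge> 1"
  shows "\<bar>SR_mean p r x - x\<bar> \<le> unit_roundoff (p + r) * \<bar>x\<bar>"
proof (cases "x = 0")
  case False
  have h: "ulp p x > 0" by (simp add: ulp_def)
  from fp_floor_ceil_cases[OF assms False] show ?thesis
  proof
    assume "fp_floor p x = x \<and> fp_ceil p x = x"
    thus ?thesis
      using unit_roundoff_nonneg[of "p + r"] by (simp add: SR_mean_eq[OF assms False])
  next
    assume "fp_ceil p x = fp_floor p x + ulp p x"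
    hence "SR_mean p r x = fl_trunc (p + r) x"
      using h by (simp add: SR_mean_eq[OF assms False] sr_prob_def)
    thus ?thesis using fl_trunc_error[of "p + r" x] assms False by simp
  qed
qed (simp add: SR_mean_0)

lemma SR_dev:
  assumes "p \<ge> 1" "w \<in> set_pmf (SR p r x)"
  shows "\<bar>w - SR_mean p r x\<bar> \<le> unit_roundoff p * \<bar>x\<bar>"
proof (cases "x = 0")
  case True
  thus ?thesis using assms(2) by (simp add: SR_def SR_mean_0)
next
  case False
  define d where "d = fp_ceil p x - fp_floor p x"
  have h: "ulp p x > 0" by (simp add: ulp_def)
  have d: "0 \<le> d" "d \<le> ulp p x"
    using fp_floor_ceil_cases[OF assms(1) False] h by (auto simp: d_def)
  have q: "0 \<le> sr_prob p r x * d" "sr_prob p r x * d \<le> d"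
    using sr_prob_bounds[OF assms(1) False, of r] d
    by (auto intro!: mult_left_le_one_le)
  have "\<bar>w - SR_mean p r x\<bar> \<le> d"
    using set_pmf_SR[OF assms(2) False] q unfolding SR_mean_eq[OF assms(1) False] d_def[symmetric]
    by (auto simp: d_def)
  also have "\<dots> \<le> unit_roundoff p * \<bar>x\<bar>"
    using d ulp_le_unit_roundoff[OF False, of p] by linarith
  finally show ?thesis .
qed

text \<open>The centred relative fluctuation. At \<open>x = 0\<close> the division yields 0, in accordance with the
  absence of a rounding error there.\<close>

definition SR_fluct :: "nat \<Rightarrow> nat \<Rightarrow> real \<Rightarrow> real \<Rightarrow> real" where
  "SR_fluct p r x w = (w - SR_mean p r x) / x"

lemma abs_SR_fluct_le:
  assumes "p \<ge> 1" "w \<in> set_pmf (SR p r x)"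
  shows "\<bar>SR_fluct p r x w\<bar> \<le> unit_roundoff p"
  using SR_dev[OF assms] unit_roundoff_nonneg[of p]
  by (cases "x = 0") (auto simp: SR_fluct_def field_simps)

lemma expectation_SR_fluct: "measure_pmf.expectation (SR p r x) (SR_fluct p r x) = 0"
proof -
  have i: "integrable (SR p r x) f" for f :: "real \<Rightarrow> real"
    by (intro integrable_measure_pmf_finite finite_set_pmf_SR)
  show ?thesis by (simp add: SR_fluct_def[abs_def] i SR_mean_def)
qed

lemma expectation_SR_fluct_sq:
  assumes "p \<ge> 1"
  shows "measure_pmf.expectation (SR p r x) (\<lambda>w. (SR_fluct p r x w)\<^sup>2) \<le> (unit_roundoff p)\<^sup>2"
proof (intro measure_pmf.integral_le_const integrable_measure_pmf_finite finite_set_pmf_SR)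
  show "AE w in SR p r x. (SR_fluct p r x w)\<^sup>2 \<le> (unit_roundoff p)\<^sup>2"
    using abs_SR_fluct_le[OF assms] unit_roundoff_nonneg[of p]
    by (auto simp: AE_measure_pmf_iff abs_le_square_iff[symmetric])
qed

text \<open>Bias and fluctuation together recover the rounded value, also at \<open>x = 0\<close>, where both sides
  vanish.\<close>

lemma SR_decomp:
  assumes "p \<ge> 1" "w \<in> set_pmf (SR p r x)"
  shows "\<exists>b. \<bar>b\<bar> \<le> unit_roundoff (p + r) \<and> w = x * (1 + SR_fluct p r x w + b)"
proof (cases "x = 0")
  case True
  thus ?thesis using assms(2) unit_roundoff_nonneg[of "p + r"]
    by (intro exI[of _ 0]) (simp add: SR_def)
next
  case False
  thus ?thesis using SR_bias[OF assms(1), of r x]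
    by (intro exI[of _ "(SR_mean p r x - x) / x"]) (auto simp: SR_fluct_def field_simps)
qed

section \<open>The unbiased shadow process\<close>

text \<open>One step of the joint law: from the computed sum \<open>s\<close> and its shadow \<open>z\<close>, the term \<open>c\<close> is
  added to both, and the shadow is perturbed by the fluctuation of the rounding only.\<close>

definition shadow_step :: "nat \<Rightarrow> nat \<Rightarrow> real \<Rightarrow> real \<times> real \<Rightarrow> (real \<times> real) pmf" where
  "shadow_step p r c sz =
     map_pmf (\<lambda>w. (w, (snd sz + c) * (1 + SR_fluct p r (fst sz + c) w))) (SR p r (fst sz + c))"

text \<open>Joint law of the computed sum and its shadow after \<open>m\<close> additions, that is, of
  \<open>m + 1\<close> terms.\<close>

fun shadow :: "nat \<Rightarrow> nat \<Rightarrow> (nat \<Rightarrow> real) \<Rightarrow> nat \<Rightarrow> (real \<times> real) pmf" where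
  "shadow p r a 0 = return_pmf (a 1, a 1)"
| "shadow p r a (Suc m) = bind_pmf (shadow p r a m) (shadow_step p r (a (Suc (Suc m))))"

lemma map_fst_shadow: "map_pmf fst (shadow p r a m) = rec_sum p r a (Suc m)"
proof (induction m)
  case (Suc m)
  have "map_pmf fst (shadow p r a (Suc m)) =
          bind_pmf (map_pmf fst (shadow p r a m)) (\<lambda>s. SR p r (s + a (Suc (Suc m))))"
    by (simp add: shadow_step_def map_bind_pmf bind_map_pmf pmf.map_comp o_def)
  thus ?case by (simp add: Suc.IH)
qed simp

lemma finite_set_pmf_shadow_step: "finite (set_pmf (shadow_step p r c sz))"
  by (simp add: shadow_step_def finite_set_pmf_SR)

lemma finite_set_pmf_shadow: "finite (set_pmf (shadow p r a m))"
  by (induction m) (auto simp: finite_set_pmf_shadow_step)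

lemma integrable_shadow: "integrable (shadow p r a m) (f :: _ \<Rightarrow> real)"
  by (intro integrable_measure_pmf_finite finite_set_pmf_shadow)

lemma shadow_sure_bounds:
  assumes "p \<ge> 1" "(s, z) \<in> set_pmf (shadow p r a m)"
  defines "u \<equiv> unit_roundoff p" and "v \<equiv> unit_roundoff (p + r)"
    and "A \<equiv> (\<lambda>k. \<Sum>i = 1..k. \<bar>a i\<bar>)"
  shows "\<bar>z\<bar> \<le> A (Suc m) * (1 + u) ^ m"
    and "\<bar>s - z\<bar> \<le> A (Suc m) * ((1 + u + v) ^ m - (1 + u) ^ m)"
proof -
  have uv: "0 \<le> u" "0 \<le> v" by (simp_all add: u_def v_def unit_roundoff_nonneg)
  have "\<bar>z\<bar> \<le> A (Suc m) * (1 + u) ^ m \<and> \<bar>s - z\<bar> \<le> A (Suc m) * ((1 + u + v) ^ m - (1 + u) ^ m)"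
    using assms(2)
  proof (induction m arbitrary: s z)
    case 0
    thus ?case by (simp add: A_def)
  next
    case (Suc m)
    define c where "c = a (Suc (Suc m))"
    define B where "B = A (Suc m)"
    define U where "U = (1 + u) ^ m"
    define W where "W = (1 + u + v) ^ m"
    have A: "A (Suc (Suc m)) = B + \<bar>c\<bar>" by (simp add: A_def B_def c_def)
    have B: "0 \<le> B" by (simp add: B_def A_def sum_nonneg)
    have U: "1 \<le> U" "U \<le> W" using uv by (auto simp: U_def W_def intro!: power_mono)
    obtain s' z' w where prev: "(s', z') \<in> set_pmf (shadow p r a m)"
      and w: "w \<in> set_pmf (SR p r (s' + c))"
      and sz: "s = w" "z = (z' + c) * (1 + SR_fluct p r (s' + c) w)"
      using Suc.prems by (auto simp: shadow_step_def c_def)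
    define al where "al = SR_fluct p r (s' + c) w"
    obtain b where b: "\<bar>b\<bar> \<le> v" "w = (s' + c) * (1 + al + b)"
      using SR_decomp[OF assms(1) w] by (auto simp: v_def al_def)
    have al: "\<bar>al\<bar> \<le> u" using abs_SR_fluct_le[OF assms(1) w] by (simp add: al_def u_def)
    have z': "\<bar>z'\<bar> \<le> B * U" and d': "\<bar>s' - z'\<bar> \<le> B * (W - U)"
      using Suc.IH[OF prev] by (auto simp: B_def U_def W_def)
    have "\<bar>c\<bar> \<le> \<bar>c\<bar> * U" using U by (simp add: mult_left_le mult_le_cancel_left1)
    hence zc: "\<bar>z' + c\<bar> \<le> (B + \<bar>c\<bar>) * U" using z' by (simp add: algebra_simps)
    have "\<bar>z\<bar> = \<bar>z' + c\<bar> * \<bar>1 + al\<bar>" by (simp add: sz al_def abs_mult)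
    also have "\<dots> \<le> ((B + \<bar>c\<bar>) * U) * (1 + u)" using zc al by (intro mult_mono) auto
    finally have 1: "\<bar>z\<bar> \<le> (B + \<bar>c\<bar>) * (U * (1 + u))" by (simp add: mult_ac)
    have dc: "\<bar>s' - z'\<bar> \<le> (B + \<bar>c\<bar>) * (W - U)"
      using d' U mult_right_mono[of B "B + \<bar>c\<bar>" "W - U"] by linarith
    have "s - z = (s' - z') * (1 + al + b) + (z' + c) * b"
      unfolding sz al_def[symmetric] by (subst b(2)) (simp add: algebra_simps)
    hence "\<bar>s - z\<bar> \<le> \<bar>s' - z'\<bar> * \<bar>1 + al + b\<bar> + \<bar>z' + c\<bar> * \<bar>b\<bar>"
      by (metis abs_mult abs_triangle_ineq)
    also have "\<dots> \<le> ((B + \<bar>c\<bar>) * (W - U)) * (1 + u + v) + ((B + \<bar>c\<bar>) * U) * v"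
      using dc zc al b(1) B U by (intro add_mono mult_mono) auto
    also have "\<dots> = (B + \<bar>c\<bar>) * (W * (1 + u + v) - U * (1 + u))" by (simp add: algebra_simps)
    finally show ?case using 1 by (simp add: A U_def W_def mult_ac)
  qed
  thus "\<bar>z\<bar> \<le> A (Suc m) * (1 + u) ^ m"
    and "\<bar>s - z\<bar> \<le> A (Suc m) * ((1 + u + v) ^ m - (1 + u) ^ m)" by auto
qed

section \<open>Second moment of the shadow process\<close>

lemma expectation_bind_pmf_finite:
  fixes h :: "'b \<Rightarrow> real"
  assumes "finite (set_pmf M)" "\<And>x. x \<in> set_pmf M \<Longrightarrow> finite (set_pmf (f x))"
  shows "measure_pmf.expectation (bind_pmf M f) h =
           measure_pmf.expectation M (\<lambda>x. measure_pmf.expectation (f x) h)"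
  using assms by (simp add: pmf_expectation_bind[where A = "set_pmf M"]
      integral_measure_pmf[where A = "set_pmf M"])

lemma shadow_step_mean: "measure_pmf.expectation (shadow_step p r c sz) snd = snd sz + c"
proof -
  have i: "integrable (SR p r x) f" for x and f :: "real \<Rightarrow> real"
    by (intro integrable_measure_pmf_finite finite_set_pmf_SR)
  show ?thesis by (simp add: shadow_step_def i distrib_left expectation_SR_fluct)
qed

text \<open>The mixed term of the square vanishes because the fluctuation is centred.\<close>

lemma shadow_step_second_moment:
  assumes "p \<ge> 1"
  shows "measure_pmf.expectation (shadow_step p r c sz) (\<lambda>sz'. (snd sz' - y)\<^sup>2) \<le>
           (snd sz + c - y)\<^sup>2 + (unit_roundoff p)\<^sup>2 * (snd sz + c)\<^sup>2"
proof -
  let ?S = "SR p r (fst sz + c)" and ?f = "SR_fluct p r (fst sz + c)" and ?q = "snd sz + c"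
  have i: "integrable ?S f" for f :: "real \<Rightarrow> real"
    by (intro integrable_measure_pmf_finite finite_set_pmf_SR)
  have "measure_pmf.expectation (shadow_step p r c sz) (\<lambda>sz'. (snd sz' - y)\<^sup>2) =
          measure_pmf.expectation ?S (\<lambda>w. (?q * (1 + ?f w) - y)\<^sup>2)"
    by (simp add: shadow_step_def)
  also have "\<dots> = measure_pmf.expectation ?S
                 (\<lambda>w. (?q - y)\<^sup>2 + 2 * (?q - y) * ?q * ?f w + ?q\<^sup>2 * (?f w)\<^sup>2)"
    by (intro Bochner_Integration.integral_cong refl) (simp add: power2_eq_square algebra_simps)
  also have "\<dots> = (?q - y)\<^sup>2 + ?q\<^sup>2 * measure_pmf.expectation ?S (\<lambda>w. (?f w)\<^sup>2)"
    by (simp add: i expectation_SR_fluct)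
  also have "\<dots> \<le> (?q - y)\<^sup>2 + ?q\<^sup>2 * (unit_roundoff p)\<^sup>2"
    by (intro add_left_mono mult_left_mono expectation_SR_fluct_sq assms) simp
  finally show ?thesis by (simp add: mult.commute)
qed

lemma shadow_moments:
  fixes a :: "nat \<Rightarrow> real"
  assumes "p \<ge> 1"
  defines "y \<equiv> (\<lambda>k. \<Sum>i = 1..k. a i)" and "A \<equiv> (\<lambda>k. \<Sum>i = 1..k. \<bar>a i\<bar>)"
    and "u \<equiv> unit_roundoff p"
  shows "measure_pmf.expectation (shadow p r a m) snd = y (Suc m)"
    and "measure_pmf.expectation (shadow p r a m) (\<lambda>sz. (snd sz - y (Suc m))\<^sup>2)
           \<le> (A (Suc m))\<^sup>2 * gamma_err m (u\<^sup>2)"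
proof -
  have "measure_pmf.expectation (shadow p r a m) snd = y (Suc m) \<and>
        measure_pmf.expectation (shadow p r a m) (\<lambda>sz. (snd sz - y (Suc m))\<^sup>2)
           \<le> (A (Suc m))\<^sup>2 * gamma_err m (u\<^sup>2)"
  proof (induction m)
    case 0
    show ?case by (simp add: y_def gamma_err_def)
  next
    case (Suc m)
    let ?M = "shadow p r a m" and ?c = "a (Suc (Suc m))"
    define Y where "Y = y (Suc (Suc m))"
    define V where "V = measure_pmf.expectation ?M (\<lambda>sz. (snd sz - y (Suc m))\<^sup>2)"
    have Y: "Y = y (Suc m) + ?c" by (simp add: Y_def y_def)
    have mean: "measure_pmf.expectation ?M snd = y (Suc m)" using Suc.IH by simp
    have A: "0 \<le> A (Suc m)" "A (Suc m) \<le> A (Suc (Suc m))" "\<bar>Y\<bar> \<le> A (Suc (Suc m))"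
      unfolding Y_def y_def A_def by (auto intro!: sum_nonneg simp del: sum.cl_ivl_Suc) simp
    have "V \<le> (A (Suc m))\<^sup>2 * gamma_err m (u\<^sup>2)" using Suc.IH by (simp add: V_def)
    also have "\<dots> \<le> (A (Suc (Suc m)))\<^sup>2 * gamma_err m (u\<^sup>2)"
      using A by (intro mult_right_mono power_mono) (auto simp: gamma_err_def)
    finally have V: "V \<le> (A (Suc (Suc m)))\<^sup>2 * gamma_err m (u\<^sup>2)" .
    have bind: "measure_pmf.expectation (shadow p r a (Suc m)) h =
        measure_pmf.expectation ?M (\<lambda>sz. measure_pmf.expectation (shadow_step p r ?c sz) h)"
      for h :: "real \<times> real \<Rightarrow> real"
      by (simp add: expectation_bind_pmf_finite finite_set_pmf_shadow finite_set_pmf_shadow_step)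
    have 1: "measure_pmf.expectation (shadow p r a (Suc m)) snd = Y"
      by (simp only: bind shadow_step_mean) (simp add: integrable_shadow mean Y)
    have "measure_pmf.expectation (shadow p r a (Suc m)) (\<lambda>sz. (snd sz - Y)\<^sup>2)
        \<le> measure_pmf.expectation ?M (\<lambda>sz. (snd sz + ?c - Y)\<^sup>2 + u\<^sup>2 * (snd sz + ?c)\<^sup>2)"
      unfolding bind u_def
      by (intro integral_mono integrable_shadow shadow_step_second_moment assms)
    \<comment> \<open>The sum \<open>z + c\<close> is split into the centred part \<open>z - y\<close> and the constant \<open>Y\<close>, so that the
      mixed term has mean 0.\<close>
    also have "\<dots> = measure_pmf.expectation ?M
        (\<lambda>sz. (1 + u\<^sup>2) * (snd sz - y (Suc m))\<^sup>2 + (2 * u\<^sup>2 * Y) * (snd sz - y (Suc m)) + u\<^sup>2 * Y\<^sup>2)"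
      by (intro Bochner_Integration.integral_cong refl)
         (simp add: Y power2_eq_square algebra_simps)
    also have "\<dots> = (1 + u\<^sup>2) * V + u\<^sup>2 * Y\<^sup>2"
      by (simp add: integrable_shadow mean V_def)
    also have "\<dots> \<le> (1 + u\<^sup>2) * ((A (Suc (Suc m)))\<^sup>2 * gamma_err m (u\<^sup>2)) + u\<^sup>2 * (A (Suc (Suc m)))\<^sup>2"
      using V A(3) power_mono[OF A(3), of 2] by (intro add_mono mult_left_mono) auto
    also have "\<dots> = (A (Suc (Suc m)))\<^sup>2 * gamma_err (Suc m) (u\<^sup>2)"
      by (simp add: gamma_err_def algebra_simps)
    finally show ?case using 1 by (simp add: Y_def)
  qed
  thus "measure_pmf.expectation (shadow p r a m) snd = y (Suc m)"
    and "measure_pmf.expectation (shadow p r a m) (\<lambda>sz. (snd sz - y (Suc m))\<^sup>2)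
           \<le> (A (Suc m))\<^sup>2 * gamma_err m (u\<^sup>2)" by auto
qed

section \<open>The probabilistic error bound\<close>

text \<open>Chebyshev's inequality in a form that remains valid for a degenerate distribution with
  \<open>V = 0\<close>, since only deviations strictly above the threshold are excluded.\<close>

lemma pmf_Chebyshev:
  fixes f :: "'a \<Rightarrow> real"
  assumes fin: "finite (set_pmf M)"
    and V: "measure_pmf.expectation M (\<lambda>x. (f x)\<^sup>2) \<le> V" and lam: "0 < lam"
  shows "measure_pmf.prob M {x. \<bar>f x\<bar> \<le> sqrt (V / lam)} \<ge> 1 - lam"
proof -
  let ?E = "measure_pmf.expectation M (\<lambda>x. (f x)\<^sup>2)" and ?t = "sqrt (V / lam)"
  let ?B = "{x. \<not> \<bar>f x\<bar> \<le> ?t}"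
  have i: "integrable M (g :: 'a \<Rightarrow> real)" for g
    by (intro integrable_measure_pmf_finite fin)
  have E: "0 \<le> ?E" by (intro integral_nonneg_AE) auto
  have prob: "measure_pmf.prob M ?B \<le> lam"
  proof (cases "V = 0")
    case True
    hence "?E = 0" using E V by linarith
    hence "AE x in M. (f x)\<^sup>2 = 0"
      by (subst (asm) integral_nonneg_eq_0_iff_AE) (auto simp: i)
    hence "measure_pmf.prob M ?B = 0"
      using True by (auto simp: measure_pmf_zero_iff AE_measure_pmf_iff)
    thus ?thesis using lam by simp
  next
    case False
    hence V0: "0 < V" using E V by linarith
    hence t: "0 < ?t" using lam by simp
    have "measure_pmf.prob M ?B \<le> measure_pmf.prob M {x \<in> space M. ?t \<le> \<bar>f x\<bar>}"
      by (intro measure_pmf.finite_measure_mono) auto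
    also have "\<dots> \<le> ?E / ?t\<^sup>2"
      by (intro measure_pmf.second_moment_method i t) auto
    also have "\<dots> \<le> lam" using V V0 lam by (simp add: field_simps)
    finally show ?thesis .
  qed
  have "{x. \<bar>f x\<bar> \<le> ?t} = space M - ?B" by auto
  hence "measure_pmf.prob M {x. \<bar>f x\<bar> \<le> ?t} = 1 - measure_pmf.prob M ?B"
    by (simp only: measure_pmf.prob_compl sets_measure_pmf UNIV_I)
  thus ?thesis using prob by simp
qed

theorem theorem4:
  fixes p r n :: nat and a :: "nat \<Rightarrow> real" and y lam :: real
  assumes "p \<ge> 1" and "r \<ge> 1" and "n \<ge> 1"
    and "y = (\<Sum>i = 1..n. a i)" and "y \<noteq> 0"
    and "0 < lam" and "lam < 1"
  shows "measure_pmf.prob (rec_sum p r a n)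
           {yhat. \<bar>yhat - y\<bar> / \<bar>y\<bar> \<le> sum_cond n a *
              (sqrt (gamma_err (n - 1) ((unit_roundoff p)\<^sup>2) / lam)
               + gamma_err (n - 1) (unit_roundoff p + unit_roundoff (p + r))
               - gamma_err (n - 1) (unit_roundoff p))}
         \<ge> 1 - lam"
proof -
  obtain m where n: "n = Suc m" using assms(3) by (cases n) auto
  define u where "u = unit_roundoff p"
  define v where "v = unit_roundoff (p + r)"
  define A where "A = (\<Sum>i = 1..n. \<bar>a i\<bar>)"
  define G where "G = gamma_err m (u\<^sup>2)"
  define H where "H = gamma_err m (u + v) - gamma_err m u"
  let ?M = "shadow p r a m"
  let ?S = "{yhat. \<bar>yhat - y\<bar> / \<bar>y\<bar> \<le> sum_cond n a * (sqrt (G / lam) + H)}"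
  have A: "0 \<le> A" by (simp add: A_def sum_nonneg)
  have "measure_pmf.expectation ?M (\<lambda>sz. (snd sz - y)\<^sup>2) \<le> A\<^sup>2 * G"
    using shadow_moments(2)[OF assms(1), of r a m] by (simp add: assms(4) n A_def G_def u_def)
  from pmf_Chebyshev[OF finite_set_pmf_shadow this assms(6)]
  have "1 - lam \<le> measure_pmf.prob ?M {sz. \<bar>snd sz - y\<bar> \<le> sqrt (A\<^sup>2 * G / lam)}" .
  also have "sqrt (A\<^sup>2 * G / lam) = A * sqrt (G / lam)"
    using A by (simp add: real_sqrt_mult real_sqrt_divide)
  \<comment> \<open>The bound on the bias holds on the support only.\<close>
  also have "measure_pmf.prob ?M {sz. \<bar>snd sz - y\<bar> \<le> A * sqrt (G / lam)} =
             measure_pmf.prob ?M ({sz. \<bar>snd sz - y\<bar> \<le> A * sqrt (G / lam)} \<inter> set_pmf ?M)"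
    by (simp add: measure_Int_set_pmf)
  also have "\<dots> \<le> measure_pmf.prob ?M (fst -` ?S)"
  proof (intro measure_pmf.finite_measure_mono subsetI)
    fix sz assume sz: "sz \<in> {sz. \<bar>snd sz - y\<bar> \<le> A * sqrt (G / lam)} \<inter> set_pmf ?M"
    have "\<bar>fst sz - snd sz\<bar> \<le> A * H"
      using shadow_sure_bounds(2)[OF assms(1), of "fst sz" "snd sz" r a m] sz
      by (simp add: A_def n H_def gamma_err_def u_def v_def add.assoc)
    hence "\<bar>fst sz - y\<bar> \<le> A * (sqrt (G / lam) + H)"
      using sz abs_triangle_ineq[of "fst sz - snd sz" "snd sz - y"] by (simp add: distrib_left)
    hence "\<bar>fst sz - y\<bar> / \<bar>y\<bar> \<le> A * (sqrt (G / lam) + H) / \<bar>y\<bar>"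
      by (intro divide_right_mono) auto
    thus "sz \<in> fst -` ?S" by (simp add: sum_cond_def A_def assms(4))
  qed auto
  also have "\<dots> = measure_pmf.prob (rec_sum p r a n) ?S"
    by (simp add: n map_fst_shadow[symmetric])
  finally show ?thesis by (simp add: G_def H_def u_def v_def n algebra_simps)
qed

end
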